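(* Let $I(n)$ be the number of ice model configurations on the two-dimensional Sierpinski gasket $SG(n)$ and let $v(SG(n))=\frac32(3^n+1)$ be its number of vertices. Then the entropy per site $S_{I,SG}=\lim_{n\to\infty}\frac{\ln I(n)}{v(SG(n))}$ equals $0.515648810655\ldots$ (decimal expansion beginning with these digits, i.e. $0.515648810655\le S_{I,SG}<0.515648810656$).
   Context: The two-dimensional Sierpinski gasket graphs $SG(n)$, $n\ge 0$, are defined recursively. $SG(0)$ is a triangle (three vertices, three edges), drawn as an equilateral triangle, with all three vertices called outmost. $SG(n+1)$ is obtained by subdividing a larger equilateral triangle into four congruent equilateral triangles, placing a copy of $SG(n)$ in each of the three corner triangles (bottom left, bottom right, top; not in the middle one), and identifying the outmost vertices of different copies that coincide (each pair of copies shares exactly one vertex). The outmost vertices of $SG(n+1)$ are the three corners of the large triangle. $SG(n)$ has $3^{n+1}$ edges and $\frac32(3^n+1)$ vertices; the three outmost vertices have degree 2 and all others have degree 4. An ice model configuration on $SG(n)$ is an assignment of an orientation to every edge such that at every vertex of degree 4 exactly two of the incident edges point toward the vertex and two point away from it. No condition is imposed at the three outmost vertices. $I(n)$ is the number of such configurations (e.g. $I(0)=8$). *)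

theory Defs
  imports Complex_Main "HOL-Library.Product_Plus"
begin

text \<open>The point \<open>(x, y)\<close> stands for \<open>x e + y f\<close> in the plane, where \<open>e, f\<close> are unit vectors at
  an angle of 60 degrees; \<open>SG(n)\<close> is drawn with corners \<open>0\<close>, \<open>2^n e\<close> and \<open>2^n f\<close>. Copies of
  \<open>SG(n)\<close> placed in the corner triangles therefore share their coinciding outmost vertices,
  and nothing else (\<open>sg_copies_meet\<close> below).\<close>

type_synonym point = "nat \<times> nat"

definition sg_outmost :: "nat \<Rightarrow> point set" where
  "sg_outmost n = {(0, 0), (2 ^ n, 0), (0, 2 ^ n)}"

fun sg_vertices :: "nat \<Rightarrow> point set" where
  "sg_vertices 0 = {(0, 0), (1, 0), (0, 1)}"
| "sg_vertices (Suc n) = (\<Union>d \<in> sg_outmost n. (\<lambda>p. d + p) ` sg_vertices n)"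

fun sg_edges :: "nat \<Rightarrow> point set set" where
  "sg_edges 0 = {{(0, 0), (1, 0)}, {(0, 0), (0, 1)}, {(1, 0), (0, 1)}}"
| "sg_edges (Suc n) = (\<Union>d \<in> sg_outmost n. (\<lambda>e. (\<lambda>p. d + p) ` e) ` sg_edges n)"

definition sg_degree :: "nat \<Rightarrow> point \<Rightarrow> nat" where
  "sg_degree n v = card {e \<in> sg_edges n. v \<in> e}"

text \<open>An orientation is given by its set of arcs; \<open>(u, v)\<close> points from \<open>u\<close> toward \<open>v\<close>.\<close>

definition orientations :: "'a set set \<Rightarrow> ('a \<times> 'a) set set" where
  "orientations E = {A. (\<forall>(u, v) \<in> A. {u, v} \<in> E) \<and>
     (\<forall>u v. {u, v} \<in> E \<longrightarrow> ((u, v) \<in> A \<longleftrightarrow> (v, u) \<notin> A))}"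

definition ice_configurations :: "nat \<Rightarrow> (point \<times> point) set set" where
  "ice_configurations n = {A \<in> orientations (sg_edges n).
     \<forall>v \<in> sg_vertices n. sg_degree n v = 4 \<longrightarrow>
       card {u. (u, v) \<in> A} = 2 \<and> card {w. (v, w) \<in> A} = 2}"

definition ice_count :: "nat \<Rightarrow> nat" where
  "ice_count n = card (ice_configurations n)"

lemma sg_vertices_triangle: "(x, y) \<in> sg_vertices n \<Longrightarrow> x + y \<le> 2 ^ n"
proof (induction n arbitrary: x y)
  case (Suc n)
  then obtain d p where "d \<in> sg_outmost n" "p \<in> sg_vertices n" "(x, y) = d + p"
    by auto
  with Suc.IH[of "fst p" "snd p"] show ?case
    by (cases p) (auto simp: sg_outmost_def)
qed auto

lemma sg_outmost_subset: "sg_outmost n \<subseteq> sg_vertices n"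
proof (induction n)
  case (Suc n)
  have "d + d \<in> sg_vertices (Suc n)" if "d \<in> sg_outmost n" for d
    using that Suc by auto
  from this[of "(0, 0)"] this[of "(2 ^ n, 0)"] this[of "(0, 2 ^ n)"]
  show ?case by (simp add: sg_outmost_def mult_2)
qed (simp add: sg_outmost_def)

lemma sg_copies_meet:
  defines "C \<equiv> \<lambda>n d. (\<lambda>p. d + p) ` sg_vertices n"
  shows "C n (0, 0) \<inter> C n (2 ^ n, 0) = {(2 ^ n, 0)}"
    and "C n (0, 0) \<inter> C n (0, 2 ^ n) = {(0, 2 ^ n)}"
    and "C n (2 ^ n, 0) \<inter> C n (0, 2 ^ n) = {(2 ^ n, 2 ^ n)}"
proof -
  have mem: "(x, y) \<in> C n (a, b) \<longleftrightarrow> a \<le> x \<and> b \<le> y \<and> (x - a, y - b) \<in> sg_vertices n"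
    for x y a b
    by (force simp: C_def image_iff)
  have o: "(0, 0) \<in> sg_vertices n" "(2 ^ n, 0) \<in> sg_vertices n" "(0, 2 ^ n) \<in> sg_vertices n"
    using sg_outmost_subset[of n] by (auto simp: sg_outmost_def)
  have "x = 2 ^ n \<and> y = 0" if "(x, y) \<in> C n (0, 0)" "(x, y) \<in> C n (2 ^ n, 0)" for x y
    using that sg_vertices_triangle[of x y n] by (simp add: mem)
  then show "C n (0, 0) \<inter> C n (2 ^ n, 0) = {(2 ^ n, 0)}"
    using o by (auto simp: mem)
  have "x = 0 \<and> y = 2 ^ n" if "(x, y) \<in> C n (0, 0)" "(x, y) \<in> C n (0, 2 ^ n)" for x y
    using that sg_vertices_triangle[of x y n] by (simp add: mem)
  then show "C n (0, 0) \<inter> C n (0, 2 ^ n) = {(0, 2 ^ n)}"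
    using o by (auto simp: mem)
  have "x = 2 ^ n \<and> y = 2 ^ n" if "(x, y) \<in> C n (2 ^ n, 0)" "(x, y) \<in> C n (0, 2 ^ n)" for x y
    using that sg_vertices_triangle[of "x - 2 ^ n" y n] sg_vertices_triangle[of x "y - 2 ^ n" n]
    unfolding mem diff_zero by linarith
  then have "C n (2 ^ n, 0) \<inter> C n (0, 2 ^ n) \<subseteq> {(2 ^ n, 2 ^ n)}"
    by (intro subrelI) blast
  moreover have "(2 ^ n, 2 ^ n) \<in> C n (2 ^ n, 0) \<inter> C n (0, 2 ^ n)"
    using o by (simp add: mem)
  ultimately show "C n (2 ^ n, 0) \<inter> C n (0, 2 ^ n) = {(2 ^ n, 2 ^ n)}"
    by blast
qed

lemma finite_sg_vertices [simp]: "finite (sg_vertices n)"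
  by (induction n) (auto simp: sg_outmost_def)

lemma card_sg_vertices: "real (card (sg_vertices n)) = 3 / 2 * (3 ^ n + 1)"
proof (induction n)
  case (Suc n)
  define C where "C = (\<lambda>d. (\<lambda>p. d + p) ` sg_vertices n)"
  let ?A = "C (0, 0)" and ?B = "C (2 ^ n, 0)" and ?D = "C (0, 2 ^ n)"
  have meet: "?A \<inter> ?B = {(2 ^ n, 0)}" "?A \<inter> ?D = {(0, 2 ^ n)}" "?B \<inter> ?D = {(2 ^ n, 2 ^ n)}"
    unfolding C_def by (fact sg_copies_meet)+
  have c: "card (C d) = card (sg_vertices n)" "finite (C d)" for d
    by (auto simp: C_def card_image inj_on_def)
  have U: "sg_vertices (Suc n) = (?A \<union> ?B) \<union> ?D"
    by (auto simp: sg_outmost_def C_def)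
  have I: "(?A \<union> ?B) \<inter> ?D = {(0, 2 ^ n), (2 ^ n, 2 ^ n)}"
    unfolding Int_Un_distrib2 meet by auto
  have "card (?A \<union> ?B) + 1 = 2 * card (sg_vertices n)"
    using card_Un_Int[of ?A ?B] c meet(1) by simp
  moreover have "card (?A \<union> ?B \<union> ?D) + 2 = card (?A \<union> ?B) + card (sg_vertices n)"
    using card_Un_Int[of "?A \<union> ?B" ?D] c by (simp add: I)
  ultimately have "card (sg_vertices (Suc n)) + 3 = 3 * card (sg_vertices n)"
    unfolding U by simp
  then have "real (card (sg_vertices (Suc n))) + 3 = 3 * real (card (sg_vertices n))"
    by linarith
  with Suc show ?case by (simp add: field_simps)
qed simp

end

theory Submission
  imports Defs "HOL-Analysis.Harmonic_Numbers"
begin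

text \<open>Record a configuration by its net flow (in-degree minus out-degree) at the three corners. Each
  corner has degree 2, so these values lie in \<open>{-2, 0, 2}\<close>, and they sum to 0: either all vanish
  (\<open>a\<^sub>n\<close> configurations) or they are a permutation of \<open>(2, -2, 0)\<close> (\<open>b\<^sub>n\<close> for each of the six).
  Where two copies are glued the flows cancel, which gives
  \<open>a\<^sub>n\<^sub>+\<^sub>1 = a\<^sub>n\<^sup>3 + 2 b\<^sub>n\<^sup>3\<close>, \<open>b\<^sub>n\<^sub>+\<^sub>1 = a\<^sub>n b\<^sub>n\<^sup>2 + b\<^sub>n\<^sup>3\<close> and \<open>I(n) = a\<^sub>n + 6 b\<^sub>n\<close>.
  With \<open>r\<^sub>n = b\<^sub>n / a\<^sub>n\<close> one has \<open>ln a\<^sub>n\<^sub>+\<^sub>1 = 3 ln a\<^sub>n + ln (1 + 2 r\<^sub>n\<^sup>3)\<close> and \<open>r\<^sub>n\<close> decreases, so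
  \<open>ln a\<^sub>n / 3\<^sup>n\<close> increases, \<open>(ln a\<^sub>n + r\<^sub>n\<^sup>3) / 3\<^sup>n\<close> decreases, and the two bracket
  \<open>3/2\<close> times the entropy to 12 digits already at \<open>n = 4\<close>.\<close>

section \<open>Orientations and net flow\<close>

lemma orientationsI:
  assumes "\<And>u v. (u, v) \<in> A \<Longrightarrow> {u, v} \<in> E"
    and "\<And>u v. {u, v} \<in> E \<Longrightarrow> (u, v) \<in> A \<longleftrightarrow> (v, u) \<notin> A"
  shows "A \<in> orientations E"
  using assms unfolding orientations_def by blast

lemma orientationsD: "A \<in> orientations E \<Longrightarrow> (u, v) \<in> A \<Longrightarrow> {u, v} \<in> E"
  unfolding orientations_def by blast

lemma orientations_iff:
  "A \<in> orientations E \<Longrightarrow> {u, v} \<in> E \<Longrightarrow> (u, v) \<in> A \<longleftrightarrow> (v, u) \<notin> A"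
  unfolding orientations_def by blast

lemma orientations_disjoint:
  assumes "A \<in> orientations E" "B \<in> orientations F" "E \<inter> F = {}"
  shows "A \<inter> B = {}"
proof (rule equals0I)
  fix a assume "a \<in> A \<inter> B"
  then show False
    using assms(3) orientationsD[OF assms(1), of "fst a" "snd a"]
      orientationsD[OF assms(2), of "fst a" "snd a"] by auto
qed

lemma orientations_finite_rel:
  assumes "A \<in> orientations E" "finite E" "\<And>e. e \<in> E \<Longrightarrow> finite e"
  shows "finite A"
proof (rule finite_subset)
  show "A \<subseteq> \<Union>E \<times> \<Union>E" using assms(1) by (auto simp: orientations_def)
  show "finite (\<Union>E \<times> \<Union>E)" using assms by auto
qed

lemma finite_orientations:
  assumes "finite E" "\<And>e. e \<in> E \<Longrightarrow> finite e"
  shows "finite (orientations E)"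
proof (rule finite_subset)
  show "orientations E \<subseteq> Pow (\<Union>E \<times> \<Union>E)" by (auto simp: orientations_def)
  show "finite (Pow (\<Union>E \<times> \<Union>E))" using assms by auto
qed

lemma orientations_edge: "u \<noteq> v \<Longrightarrow> orientations {{u, v}} = {{(u, v)}, {(v, u)}}"
proof (rule set_eqI)
  fix A assume "u \<noteq> v"
  have "A \<in> orientations {{u, v}} \<longleftrightarrow> A \<subseteq> {(u, v), (v, u)} \<and> ((u, v) \<in> A \<longleftrightarrow> (v, u) \<notin> A)"
    by (auto simp: orientations_def doubleton_eq_iff)
  also have "\<dots> \<longleftrightarrow> A \<in> {{(u, v)}, {(v, u)}}" using \<open>u \<noteq> v\<close> by auto
  finally show "A \<in> orientations {{u, v}} \<longleftrightarrow> A \<in> {{(u, v)}, {(v, u)}}" .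
qed

lemma orientations_restrict:
  assumes "A \<in> orientations E" "F \<subseteq> E"
  shows "{(u, v) \<in> A. {u, v} \<in> F} \<in> orientations F"
  using assms by (auto simp: orientations_def insert_commute)

text \<open>Edge-disjoint pieces are oriented independently of each other. Every arc determines its
  underlying edge, so an orientation of the union is taken apart by sorting arcs according to
  whether that edge lies in \<open>E\<close> or in \<open>F\<close>.\<close>

lemma bij_betw_orientations_Un:
  assumes "E \<inter> F = {}"
  shows "bij_betw (\<lambda>(A, B). A \<union> B) (orientations E \<times> orientations F) (orientations (E \<union> F))"
proof (rule bij_betw_byWitness[where f' =
      "\<lambda>A. ({(u, v) \<in> A. {u, v} \<in> E}, {(u, v) \<in> A. {u, v} \<in> F})"])
  have "{(u, v) \<in> A \<union> B. {u, v} \<in> E} = A" "{(u, v) \<in> A \<union> B. {u, v} \<in> F} = B"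
    if "A \<in> orientations E" "B \<in> orientations F" for A B
  proof -
    have "{u, v} \<in> E \<and> {u, v} \<notin> F" if "(u, v) \<in> A" for u v
      using orientationsD[OF \<open>A \<in> orientations E\<close> that] assms by blast
    moreover have "{u, v} \<in> F \<and> {u, v} \<notin> E" if "(u, v) \<in> B" for u v
      using orientationsD[OF \<open>B \<in> orientations F\<close> that] assms by blast
    ultimately show "{(u, v) \<in> A \<union> B. {u, v} \<in> E} = A" "{(u, v) \<in> A \<union> B. {u, v} \<in> F} = B"
      unfolding set_eq_iff split_paired_All mem_Collect_eq case_prod_conv Un_iff by blast+
  qed
  then show "\<forall>a\<in>orientations E \<times> orientations F.
      (\<lambda>A. ({(u, v) \<in> A. {u, v} \<in> E}, {(u, v) \<in> A. {u, v} \<in> F})) ((\<lambda>(A, B). A \<union> B) a) = a"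
    by auto
  show "\<forall>A\<in>orientations (E \<union> F).
      (\<lambda>(A, B). A \<union> B) ({(u, v) \<in> A. {u, v} \<in> E}, {(u, v) \<in> A. {u, v} \<in> F}) = A"
    by (auto dest: orientationsD)
  show "(\<lambda>(A, B). A \<union> B) ` (orientations E \<times> orientations F) \<subseteq> orientations (E \<union> F)"
  proof clarsimp
    fix A B assume A: "A \<in> orientations E" and B: "B \<in> orientations F"
    show "A \<union> B \<in> orientations (E \<union> F)"
    proof (rule orientationsI)
      fix u v
      show "{u, v} \<in> E \<union> F" if "(u, v) \<in> A \<union> B"
        using that orientationsD[OF A] orientationsD[OF B] by blast
      have "{v, u} = {u, v}" by auto
      then show "(u, v) \<in> A \<union> B \<longleftrightarrow> (v, u) \<notin> A \<union> B" if "{u, v} \<in> E \<union> F"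
        using that assms orientations_iff[OF A, of u v] orientations_iff[OF B, of u v]
          orientationsD[OF A, of u v] orientationsD[OF A, of v u]
          orientationsD[OF B, of u v] orientationsD[OF B, of v u]
        by auto
    qed
  qed
  show "(\<lambda>A. ({(u, v) \<in> A. {u, v} \<in> E}, {(u, v) \<in> A. {u, v} \<in> F})) ` orientations (E \<union> F)
      \<subseteq> orientations E \<times> orientations F"
    by (auto intro: orientations_restrict)
qed

lemma bij_betw_orientations_Un3:
  assumes "E \<inter> F = {}" "E \<inter> G = {}" "F \<inter> G = {}"
  shows "bij_betw (\<lambda>(A, B, C). A \<union> (B \<union> C))
    (orientations E \<times> orientations F \<times> orientations G) (orientations (E \<union> (F \<union> G)))"
proof -
  have "bij_betw (map_prod id (\<lambda>(B, C). B \<union> C))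
      (orientations E \<times> orientations F \<times> orientations G) (orientations E \<times> orientations (F \<union> G))"
    using assms by (intro bij_betw_map_prod bij_betw_orientations_Un) auto
  moreover have "bij_betw (\<lambda>(A, B). A \<union> B)
      (orientations E \<times> orientations (F \<union> G)) (orientations (E \<union> (F \<union> G)))"
    using assms by (intro bij_betw_orientations_Un) auto
  ultimately have "bij_betw ((\<lambda>(A, B). A \<union> B) \<circ> map_prod id (\<lambda>(B, C). B \<union> C))
      (orientations E \<times> orientations F \<times> orientations G) (orientations (E \<union> (F \<union> G)))"
    by (rule bij_betw_trans)
  then show ?thesis by (rule bij_betw_cong[THEN iffD1, rotated]) auto
qed

section \<open>Net flow, and its behaviour under unions and relabellings\<close>

definition net_flow :: "('a \<times> 'a) set \<Rightarrow> 'a \<Rightarrow> int" where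
  "net_flow A v = int (card {u. (u, v) \<in> A}) - int (card {w. (v, w) \<in> A})"

lemma finite_arcs: "finite A \<Longrightarrow> finite {u. (u, v) \<in> A}" "finite A \<Longrightarrow> finite {w. (v, w) \<in> A}"
  by (rule finite_subset[of _ "fst ` A"], force, simp, rule finite_subset[of _ "snd ` A"], force, simp)

text \<open>This additivity turns gluing into arithmetic: at a vertex shared by two copies the flow
  is the sum of the flows in the copies.\<close>

lemma net_flow_Un:
  assumes "finite A" "finite B" "A \<inter> B = {}"
  shows "net_flow (A \<union> B) v = net_flow A v + net_flow B v"
proof -
  have "card {u. (u, v) \<in> A \<union> B} = card {u. (u, v) \<in> A} + card {u. (u, v) \<in> B}"
    using assms by (subst card_Un_disjoint[symmetric]) (auto simp: finite_arcs intro: arg_cong[of _ _ card])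
  moreover have "card {w. (v, w) \<in> A \<union> B} = card {w. (v, w) \<in> A} + card {w. (v, w) \<in> B}"
    using assms by (subst card_Un_disjoint[symmetric]) (auto simp: finite_arcs intro: arg_cong[of _ _ card])
  ultimately show ?thesis by (simp add: net_flow_def)
qed

lemma net_flow_singleton: "net_flow {(a, b)} v = of_bool (v = b) - of_bool (v = a)"
  by (cases "v = a"; cases "v = b") (simp_all add: net_flow_def)

text \<open>Each incident edge is directed either toward \<open>v\<close> or away from it, so
  in-neighbours and out-neighbours are disjoint and \<open>u \<mapsto> {u, v}\<close> maps their
  union bijectively onto the incident edges. With the degree known, the net flow thus determines
  both the in-degree and the out-degree.\<close>

lemma card_in_arcs_add_card_out_arcs:
  assumes A: "A \<in> orientations E" and E: "\<And>e. e \<in> E \<Longrightarrow> card e = 2" "finite E"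
  shows "card {u. (u, v) \<in> A} + card {w. (v, w) \<in> A} = card {e \<in> E. v \<in> e}"
proof -
  let ?I = "{u. (u, v) \<in> A}" and ?O = "{w. (v, w) \<in> A}"
  have "finite A"
    using A E by (intro orientations_finite_rel) (auto intro: card_ge_0_finite)
  have ori: "(u, w) \<in> A \<Longrightarrow> {u, w} \<in> E" "{u, w} \<in> E \<Longrightarrow> (u, w) \<in> A \<longleftrightarrow> (w, u) \<notin> A" for u w
    using A by (auto simp: orientations_def)
  have "?I \<inter> ?O = {}" using ori by blast
  then have "card ?I + card ?O = card (?I \<union> ?O)"
    using \<open>finite A\<close> by (simp add: card_Un_disjoint finite_arcs)
  also have "\<dots> = card ((\<lambda>u. {u, v}) ` (?I \<union> ?O))"
    by (rule card_image[symmetric]) (auto simp: inj_on_def doubleton_eq_iff)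
  also have "(\<lambda>u. {u, v}) ` (?I \<union> ?O) = {e \<in> E. v \<in> e}"
  proof (intro equalityI subsetI)
    fix e assume e: "e \<in> {e \<in> E. v \<in> e}"
    then obtain w where "e = {w, v}" using E(1)[of e] by (auto simp: card_2_iff)
    then show "e \<in> (\<lambda>u. {u, v}) ` (?I \<union> ?O)" using e ori(2)[of w v] by blast
  next
    fix e assume "e \<in> (\<lambda>u. {u, v}) ` (?I \<union> ?O)"
    then obtain w where "e = {w, v}" "(w, v) \<in> A \<or> (v, w) \<in> A" by blast
    then show "e \<in> {e \<in> E. v \<in> e}" using ori(1)[of w v] ori(1)[of v w] by (auto simp: insert_commute)
  qed
  finally show ?thesis .
qed

lemma net_flow_image:
  assumes "inj f"
  shows "net_flow (map_prod f f ` A) (f v) = net_flow A v"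
proof -
  have "{u. (u, f v) \<in> map_prod f f ` A} = f ` {u. (u, v) \<in> A}"
    and "{w. (f v, w) \<in> map_prod f f ` A} = f ` {w. (v, w) \<in> A}"
    using assms by (force simp: inj_eq)+
  then show ?thesis
    using assms by (simp add: net_flow_def card_image inj_on_subset)
qed

lemma net_flow_image_outside: "v \<notin> range f \<Longrightarrow> net_flow (map_prod f f ` A) v = 0"
proof -
  assume "v \<notin> range f"
  then have "{u. (u, v) \<in> map_prod f f ` A} = {}" "{w. (v, w) \<in> map_prod f f ` A} = {}"
    by auto
  then show ?thesis by (simp add: net_flow_def)
qed

text \<open>Needed for translations. Given an orientation of the image graph, every endpoint of an
  arc lies in an image edge and hence in the range of \<open>f\<close>, so pulling back along
  \<open>f\<close> loses no arc.\<close>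

lemma orientations_image:
  assumes "inj f"
  shows "orientations ((\<lambda>e. f ` e) ` E) = (\<lambda>A. map_prod f f ` A) ` orientations E"
proof (intro equalityI subsetI)
  have edge: "{f u, f v} \<in> (\<lambda>e. f ` e) ` E \<longleftrightarrow> {u, v} \<in> E" for u v
  proof -
    have "f ` e = {f u, f v} \<longleftrightarrow> e = {u, v}" for e
      using inj_image_eq_iff[OF assms, of e "{u, v}"] by simp
    then show ?thesis by (auto simp: image_iff eq_commute[of "{f u, f v}"])
  qed
  fix A assume A: "A \<in> orientations ((\<lambda>e. f ` e) ` E)"
  define B where "B = {(u, v). (f u, f v) \<in> A}"
  have "u \<in> range f \<and> v \<in> range f" if "(u, v) \<in> A" for u v
  proof -
    have "{u, v} \<in> (\<lambda>e. f ` e) ` E" using A that by (rule orientationsD)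
    then obtain e where "{u, v} = f ` e" by blast
    then show ?thesis by blast
  qed
  then have "A = map_prod f f ` B" unfolding B_def by force
  moreover have "B \<in> orientations E"
  proof (rule orientationsI)
    fix u v
    show "(u, v) \<in> B \<Longrightarrow> {u, v} \<in> E"
      using orientationsD[OF A, of "f u" "f v"] edge[of u v] by (simp add: B_def)
    show "{u, v} \<in> E \<Longrightarrow> (u, v) \<in> B \<longleftrightarrow> (v, u) \<notin> B"
      using orientations_iff[OF A, of "f u" "f v"] edge[of u v] by (simp add: B_def)
  qed
  ultimately show "A \<in> (\<lambda>A. map_prod f f ` A) ` orientations E" by blast
next
  fix A' assume "A' \<in> (\<lambda>A. map_prod f f ` A) ` orientations E"
  then obtain A where A: "A \<in> orientations E" "A' = map_prod f f ` A" by auto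
  have mem: "(f u, f v) \<in> A' \<longleftrightarrow> (u, v) \<in> A" for u v
    using assms by (auto simp: A(2) inj_eq)
  show "A' \<in> orientations ((\<lambda>e. f ` e) ` E)"
  proof (rule orientationsI)
    fix u v
    show "{u, v} \<in> (\<lambda>e. f ` e) ` E" if "(u, v) \<in> A'"
    proof -
      from that obtain a b where ab: "u = f a" "v = f b" "(a, b) \<in> A" by (auto simp: A(2))
      then have "{a, b} \<in> E" using orientationsD[OF A(1)] by blast
      with ab show ?thesis by (auto intro: image_eqI[of _ _ "{a, b}"])
    qed
    show "(u, v) \<in> A' \<longleftrightarrow> (v, u) \<notin> A'" if uv: "{u, v} \<in> (\<lambda>e. f ` e) ` E"
    proof -
      obtain e where e: "e \<in> E" "{u, v} = f ` e" using uv by blast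
      then obtain a b where ab: "u = f a" "v = f b" by blast
      then have "f ` e = f ` {a, b}" using e by simp
      then have "e = {a, b}" by (rule inj_image_eq_iff[OF assms, THEN iffD1])
      then show ?thesis using orientations_iff[OF A(1), of a b] e ab mem by simp
    qed
  qed
qed

section \<open>Gluing three copies of the gasket\<close>

definition copy_vertices :: "nat \<Rightarrow> point \<Rightarrow> point set" where
  "copy_vertices n d = (\<lambda>p. d + p) ` sg_vertices n"

definition copy_outmost :: "nat \<Rightarrow> point \<Rightarrow> point set" where
  "copy_outmost n d = {d, d + (2 ^ n, 0), d + (0, 2 ^ n)}"

definition copy_edges :: "nat \<Rightarrow> point \<Rightarrow> point set set" where
  "copy_edges n d = (\<lambda>e. (\<lambda>p. d + p) ` e) ` sg_edges n"

text \<open>The gasket itself is its own copy at offset \<open>(0, 0)\<close>, so facts about copies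
  specialise to it.\<close>

lemma copy_vertices_origin: "copy_vertices n (0, 0) = sg_vertices n"
  and copy_outmost_origin: "copy_outmost n (0, 0) = sg_outmost n"
  and copy_edges_origin: "copy_edges n (0, 0) = sg_edges n"
  by (simp_all add: copy_vertices_def copy_outmost_def copy_edges_def sg_outmost_def flip: zero_prod_def)

lemma sg_vertices_Suc: "sg_vertices (Suc n) =
    copy_vertices n (0, 0) \<union> copy_vertices n (2 ^ n, 0) \<union> copy_vertices n (0, 2 ^ n)"
  by (auto simp: copy_vertices_def sg_outmost_def)

lemma sg_edges_Suc: "sg_edges (Suc n) =
    copy_edges n (0, 0) \<union> (copy_edges n (2 ^ n, 0) \<union> copy_edges n (0, 2 ^ n))"
  by (auto simp: copy_edges_def sg_outmost_def)

lemma copy_outmost_subset: "copy_outmost n d \<subseteq> copy_vertices n d"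
proof -
  have "copy_outmost n d = (\<lambda>p. d + p) ` sg_outmost n"
    by (simp add: copy_outmost_def sg_outmost_def flip: zero_prod_def)
  then show ?thesis using sg_outmost_subset[of n] by (auto simp: copy_vertices_def)
qed

lemma copy_vertices_bounds:
  "(x, y) \<in> copy_vertices n (a, b) \<Longrightarrow> a \<le> x \<and> b \<le> y \<and> x + y \<le> a + b + 2 ^ n"
  using sg_vertices_triangle by (fastforce simp: copy_vertices_def)

text \<open>Incidence table for the six special points of the next gasket: each of its three corners
  lies in one copy, each of the junctions \<open>(M, 0)\<close>, \<open>(0, M)\<close>,
  \<open>(M, M)\<close> in two. Exclusions come from the coordinate bounds, inclusions from the
  corners of the copies.\<close>

lemma junctions:
  fixes n :: nat
  defines "M \<equiv> 2 ^ n :: nat"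
  shows "(0, 0) \<in> copy_vertices n (0, 0)" "(M, 0) \<in> copy_vertices n (0, 0)"
    "(0, M) \<in> copy_vertices n (0, 0)" "(M, M) \<notin> copy_vertices n (0, 0)"
    "(2 * M, 0) \<notin> copy_vertices n (0, 0)" "(0, 2 * M) \<notin> copy_vertices n (0, 0)"
    "(0, 0) \<notin> copy_vertices n (M, 0)" "(M, 0) \<in> copy_vertices n (M, 0)"
    "(0, M) \<notin> copy_vertices n (M, 0)" "(M, M) \<in> copy_vertices n (M, 0)"
    "(2 * M, 0) \<in> copy_vertices n (M, 0)" "(0, 2 * M) \<notin> copy_vertices n (M, 0)"
    "(0, 0) \<notin> copy_vertices n (0, M)" "(M, 0) \<notin> copy_vertices n (0, M)"
    "(0, M) \<in> copy_vertices n (0, M)" "(M, M) \<in> copy_vertices n (0, M)"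
    "(2 * M, 0) \<notin> copy_vertices n (0, M)" "(0, 2 * M) \<in> copy_vertices n (0, M)"
proof -
  have "0 < M" by (simp add: M_def)
  note b = copy_vertices_bounds[of _ _ n, folded M_def]
  show "(M, M) \<notin> copy_vertices n (0, 0)"
    "(2 * M, 0) \<notin> copy_vertices n (0, 0)" "(0, 2 * M) \<notin> copy_vertices n (0, 0)"
    "(0, 0) \<notin> copy_vertices n (M, 0)"
    "(0, M) \<notin> copy_vertices n (M, 0)" "(0, 2 * M) \<notin> copy_vertices n (M, 0)"
    "(0, 0) \<notin> copy_vertices n (0, M)" "(M, 0) \<notin> copy_vertices n (0, M)"
    "(2 * M, 0) \<notin> copy_vertices n (0, M)"
    using \<open>0 < M\<close> by (auto dest!: b)
  show "(0, 0) \<in> copy_vertices n (0, 0)" "(M, 0) \<in> copy_vertices n (0, 0)"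
    "(0, M) \<in> copy_vertices n (0, 0)" "(M, 0) \<in> copy_vertices n (M, 0)"
    "(M, M) \<in> copy_vertices n (M, 0)" "(2 * M, 0) \<in> copy_vertices n (M, 0)"
    "(0, M) \<in> copy_vertices n (0, M)" "(M, M) \<in> copy_vertices n (0, M)"
    "(0, 2 * M) \<in> copy_vertices n (0, M)"
    using copy_outmost_subset[of n "(0, 0)"] copy_outmost_subset[of n "(M, 0)"]
      copy_outmost_subset[of n "(0, M)"]
    by (simp_all add: copy_outmost_def M_def mult_2)
qed

lemma copies_meet:
  "v \<in> copy_vertices n (0, 0) \<Longrightarrow> v \<in> copy_vertices n (2 ^ n, 0) \<Longrightarrow> v = (2 ^ n, 0)"
  "v \<in> copy_vertices n (0, 0) \<Longrightarrow> v \<in> copy_vertices n (0, 2 ^ n) \<Longrightarrow> v = (0, 2 ^ n)"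
  "v \<in> copy_vertices n (2 ^ n, 0) \<Longrightarrow> v \<in> copy_vertices n (0, 2 ^ n) \<Longrightarrow> v = (2 ^ n, 2 ^ n)"
  using sg_copies_meet[of n] unfolding copy_vertices_def by blast+

section \<open>Edges and vertex degrees\<close>

lemma finite_sg_edges [simp]: "finite (sg_edges n)"
  by (induction n) (auto simp: sg_outmost_def)

lemma sg_edges_subset: "e \<in> sg_edges n \<Longrightarrow> e \<subseteq> sg_vertices n"
  by (induction n arbitrary: e) fastforce+

lemma card_sg_edge: "e \<in> sg_edges n \<Longrightarrow> card e = 2"
proof (induction n arbitrary: e)
  case (Suc n)
  then show ?case by (auto simp: card_image)
qed auto

lemma finite_copy_edges [simp]: "finite (copy_edges n d)"
  by (simp add: copy_edges_def)

lemma card_copy_edge: "e \<in> copy_edges n d \<Longrightarrow> card e = 2"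
  by (auto simp: copy_edges_def card_image card_sg_edge)

lemma finite_copy_edge: "e \<in> copy_edges n d \<Longrightarrow> finite e"
  using card_copy_edge[of e n d] by (intro card_ge_0_finite) simp

lemma copy_edges_subset: "e \<in> copy_edges n d \<Longrightarrow> e \<subseteq> copy_vertices n d"
  using sg_edges_subset by (fastforce simp: copy_edges_def copy_vertices_def)

text \<open>Two copies share a single vertex, whereas an edge has two endpoints.\<close>

lemma copy_edges_disjoint:
  "copy_edges n (0, 0) \<inter> copy_edges n (2 ^ n, 0) = {}"
  "copy_edges n (0, 0) \<inter> copy_edges n (0, 2 ^ n) = {}"
  "copy_edges n (2 ^ n, 0) \<inter> copy_edges n (0, 2 ^ n) = {}"
proof -
  have "copy_edges n d \<inter> copy_edges n d' = {}"
    if meet: "\<And>v. v \<in> copy_vertices n d \<Longrightarrow> v \<in> copy_vertices n d' \<Longrightarrow> v = w" for d d' w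
  proof (rule equals0I)
    fix e assume e: "e \<in> copy_edges n d \<inter> copy_edges n d'"
    then have "e \<subseteq> {w}" using copy_edges_subset[of e n] meet by blast
    then have "card e \<le> 1" using card_mono[of "{w}" e] by simp
    with e show False using card_copy_edge[of e n d] by simp
  qed
  from this[OF copies_meet(1)] this[OF copies_meet(2)] this[OF copies_meet(3)]
  show "copy_edges n (0, 0) \<inter> copy_edges n (2 ^ n, 0) = {}"
    "copy_edges n (0, 0) \<inter> copy_edges n (0, 2 ^ n) = {}"
    "copy_edges n (2 ^ n, 0) \<inter> copy_edges n (0, 2 ^ n) = {}"
    by blast+
qed

text \<open>Translation preserves degrees. The degree formula is a hypothesis so that the lemma can
  serve with the induction hypothesis inside the proof of \<open>sg_degree_eq\<close>, and with
  \<open>sg_degree_eq\<close> itself afterwards.\<close>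

lemma copy_degree:
  assumes "\<And>v. sg_degree n v = (if v \<in> sg_outmost n then 2 else if v \<in> sg_vertices n then 4 else 0)"
  shows "card {e \<in> copy_edges n d. v \<in> e} =
    (if v \<in> copy_outmost n d then 2 else if v \<in> copy_vertices n d then 4 else 0)"
proof (cases "v \<in> range (\<lambda>p. d + p)")
  case True
  then obtain w where w: "v = d + w" by blast
  have "{e \<in> copy_edges n d. v \<in> e} = (\<lambda>e. (\<lambda>p. d + p) ` e) ` {e \<in> sg_edges n. w \<in> e}"
    by (auto simp: copy_edges_def w)
  also have "card \<dots> = sg_degree n w"
    unfolding sg_degree_def by (intro card_image inj_onI) (simp add: inj_image_eq_iff)
  finally have "card {e \<in> copy_edges n d. v \<in> e} = sg_degree n w" .
  moreover have "v \<in> copy_vertices n d \<longleftrightarrow> w \<in> sg_vertices n"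
    by (auto simp: copy_vertices_def w)
  moreover have "v \<in> copy_outmost n d \<longleftrightarrow> w \<in> sg_outmost n"
    by (cases w; cases d) (auto simp: copy_outmost_def sg_outmost_def w)
  ultimately show ?thesis by (simp add: assms)
next
  case False
  then have "v \<notin> copy_vertices n d" "{e \<in> copy_edges n d. v \<in> e} = {}"
    by (auto simp: copy_vertices_def copy_edges_def)
  then show ?thesis using copy_outmost_subset[of n d] by auto
qed

text \<open>Degrees add over the edge-disjoint copies: a junction is a corner of two copies and gets
  2 + 2, while any other vertex keeps the degree it has in its only copy. Consequently the ice rule
  applies to exactly the vertices that are not outmost.\<close>

lemma sg_degree_eq:
  "sg_degree n v = (if v \<in> sg_outmost n then 2 else if v \<in> sg_vertices n then 4 else 0)"
proof (induction n arbitrary: v)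
  case 0
  have "{e \<in> sg_edges 0. v \<in> e} = (if v = (0, 0) then {{(0, 0), (1, 0)}, {(0, 0), (0, 1)}}
     else if v = (1, 0) then {{(0, 0), (1, 0)}, {(1, 0), (0, 1)}}
     else if v = (0, 1) then {{(0, 0), (0, 1)}, {(1, 0), (0, 1)}} else {})"
    by auto
  then show ?case
    by (auto simp: sg_degree_def sg_outmost_def card_insert_if doubleton_eq_iff)
next
  case (Suc n)
  let ?N = "\<lambda>d. {e \<in> copy_edges n d. v \<in> e}"
  have U: "{e \<in> sg_edges (Suc n). v \<in> e} = ?N (0, 0) \<union> (?N (2 ^ n, 0) \<union> ?N (0, 2 ^ n))"
    unfolding sg_edges_Suc by auto
  have deg: "sg_degree (Suc n) v = card (?N (0, 0)) + (card (?N (2 ^ n, 0)) + card (?N (0, 2 ^ n)))"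
    unfolding sg_degree_def U
    using copy_edges_disjoint[of n] by (subst card_Un_disjoint, simp, simp, blast)+ simp
  define M :: nat where "M = 2 ^ n"
  have "0 < M" by (simp add: M_def)
  note j = junctions[of n, folded M_def] and m = copies_meet[of v n, folded M_def]
  have V: "v \<in> sg_vertices (Suc n) \<longleftrightarrow> v \<in> copy_vertices n (0, 0)
      \<or> v \<in> copy_vertices n (M, 0) \<or> v \<in> copy_vertices n (0, M)"
    unfolding sg_vertices_Suc M_def by blast
  have O: "v \<in> sg_outmost (Suc n) \<longleftrightarrow> v \<in> {(0, 0), (2 * M, 0), (0, 2 * M)}"
    by (simp add: sg_outmost_def M_def)
  have C: "copy_outmost n (0, 0) = {(0, 0), (M, 0), (0, M)}"
    "copy_outmost n (M, 0) = {(M, 0), (2 * M, 0), (M, M)}"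
    "copy_outmost n (0, M) = {(0, M), (M, M), (0, 2 * M)}"
    by (simp_all add: copy_outmost_def M_def mult_2)
  show ?case
    unfolding deg copy_degree[OF Suc] V O C M_def[symmetric]
  \<comment> \<open>At the six special points the incidence table decides everything; any other
    point lies in at most one copy.\<close>
  proof (cases "v \<in> {(0, 0), (M, 0), (0, M), (M, M), (2 * M, 0), (0, 2 * M)}")
    case True
    then show "(if v \<in> {(0, 0), (M, 0), (0, M)} then 2
        else if v \<in> copy_vertices n (0, 0) then 4 else 0) +
      ((if v \<in> {(M, 0), (2 * M, 0), (M, M)} then 2
        else if v \<in> copy_vertices n (M, 0) then 4 else 0) +
       (if v \<in> {(0, M), (M, M), (0, 2 * M)} then 2
        else if v \<in> copy_vertices n (0, M) then 4 else 0)) =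
      (if v \<in> {(0, 0), (2 * M, 0), (0, 2 * M)} then 2
       else if v \<in> copy_vertices n (0, 0) \<or> v \<in> copy_vertices n (M, 0)
         \<or> v \<in> copy_vertices n (0, M) then 4 else (0 :: nat))"
      using \<open>0 < M\<close> by (elim insertE emptyE) (simp_all add: j)
  next
    case False
    with m have "\<not> (v \<in> copy_vertices n (0, 0) \<and> v \<in> copy_vertices n (M, 0))"
      "\<not> (v \<in> copy_vertices n (0, 0) \<and> v \<in> copy_vertices n (0, M))"
      "\<not> (v \<in> copy_vertices n (M, 0) \<and> v \<in> copy_vertices n (0, M))"
      by blast+
    with False show "(if v \<in> {(0, 0), (M, 0), (0, M)} then 2
        else if v \<in> copy_vertices n (0, 0) then 4 else 0) +
      ((if v \<in> {(M, 0), (2 * M, 0), (M, M)} then 2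
        else if v \<in> copy_vertices n (M, 0) then 4 else 0) +
       (if v \<in> {(0, M), (M, M), (0, 2 * M)} then 2
        else if v \<in> copy_vertices n (0, M) then 4 else 0)) =
      (if v \<in> {(0, 0), (2 * M, 0), (0, 2 * M)} then 2
       else if v \<in> copy_vertices n (0, 0) \<or> v \<in> copy_vertices n (M, 0)
         \<or> v \<in> copy_vertices n (0, M) then 4 else (0 :: nat))"
      by auto
  qed
qed

text \<open>In-degree and out-degree sum to the degree. This is 0 outside the copy, and 2 at a
  corner, where the difference is therefore even and at most 2 in absolute value.\<close>

lemma net_flow_copy:
  assumes A: "A \<in> orientations (copy_edges n d)"
  shows "v \<notin> copy_vertices n d \<Longrightarrow> net_flow A v = 0"
    and "v \<in> copy_outmost n d \<Longrightarrow> net_flow A v \<in> {-2, 0, 2}"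
proof -
  have deg: "card {u. (u, v) \<in> A} + card {w. (v, w) \<in> A} =
      (if v \<in> copy_outmost n d then 2 else if v \<in> copy_vertices n d then 4 else 0)"
    using card_in_arcs_add_card_out_arcs[OF A card_copy_edge finite_copy_edges, where v = v]
      copy_degree[OF sg_degree_eq] by simp
  show "net_flow A v = 0" if "v \<notin> copy_vertices n d"
    using deg that copy_outmost_subset[of n d] by (auto simp: net_flow_def split: if_splits)
  show "net_flow A v \<in> {-2, 0, 2}" if "v \<in> copy_outmost n d"
  proof -
    have "card {u. (u, v) \<in> A} + card {w. (v, w) \<in> A} = 2" using deg that by simp
    then show ?thesis unfolding net_flow_def insert_iff empty_iff by presburger
  qed
qed

section \<open>Configurations with prescribed corner flows, and how they glue\<close>

definition corner_flow :: "nat \<Rightarrow> point \<Rightarrow> int \<Rightarrow> int \<Rightarrow> int \<Rightarrow> point \<Rightarrow> int" where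
  "corner_flow n d x y z v = (if v = d then x else 0)
     + (if v = d + (2 ^ n, 0) then y else 0) + (if v = d + (0, 2 ^ n) then z else 0)"

text \<open>Since \<open>corner_flow\<close> is defined at every point and vanishes away from the
  corners, one equation between functions prescribes the corner values and at the same time imposes
  the ice rule at all remaining vertices.\<close>

definition flow_configs :: "nat \<Rightarrow> point \<Rightarrow> int \<Rightarrow> int \<Rightarrow> int \<Rightarrow> (point \<times> point) set set" where
  "flow_configs n d x y z = {A \<in> orientations (copy_edges n d). net_flow A = corner_flow n d x y z}"

definition flow_count :: "nat \<Rightarrow> int \<Rightarrow> int \<Rightarrow> int \<Rightarrow> nat" where
  "flow_count n x y z = card (flow_configs n (0, 0) x y z)"

lemma finite_copy_orientations [simp]: "finite (orientations (copy_edges n d))"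
  by (intro finite_orientations finite_copy_edge finite_copy_edges)

lemma finite_copy_orientation: "A \<in> orientations (copy_edges n d) \<Longrightarrow> finite A"
  by (rule orientations_finite_rel[OF _ finite_copy_edges finite_copy_edge])

lemma finite_flow_configs [simp]: "finite (flow_configs n d x y z)"
  by (simp add: flow_configs_def)

text \<open>The count is invariant under translation. As translations of pairs of naturals are not
  surjective, points outside their range are treated separately: no arc touches them, and no corner
  is among them.\<close>

lemma card_flow_configs: "card (flow_configs n d x y z) = flow_count n x y z"
proof -
  let ?f = "\<lambda>p. d + p"
  have "inj ?f" by simp
  have "net_flow (map_prod ?f ?f ` A) = corner_flow n d x y z \<longleftrightarrow>
      net_flow A = corner_flow n (0, 0) x y z" for A
  proof
    assume L: "net_flow (map_prod ?f ?f ` A) = corner_flow n d x y z"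
    show "net_flow A = corner_flow n (0, 0) x y z"
    proof
      fix v
      have "net_flow A v = corner_flow n d x y z (d + v)"
        using net_flow_image[OF \<open>inj ?f\<close>, of A v] L by simp
      then show "net_flow A v = corner_flow n (0, 0) x y z v"
        by (simp add: corner_flow_def flip: zero_prod_def)
    qed
  next
    assume R: "net_flow A = corner_flow n (0, 0) x y z"
    show "net_flow (map_prod ?f ?f ` A) = corner_flow n d x y z"
    proof
      fix v
      show "net_flow (map_prod ?f ?f ` A) v = corner_flow n d x y z v"
      proof (cases "v \<in> range ?f")
        case True
        then obtain w where w: "v = d + w" by blast
        show ?thesis
          unfolding w net_flow_image[OF \<open>inj ?f\<close>] R by (simp add: corner_flow_def flip: zero_prod_def)
      next
        case False
        \<comment> \<open>Exhibits the corner \<open>d\<close> itself as a member of the range of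
          the translation.\<close>
        have "d = d + 0" by simp
        then have "v \<noteq> d" "v \<noteq> d + (2 ^ n, 0)" "v \<noteq> d + (0, 2 ^ n)"
          using False by blast+
        then show ?thesis
          unfolding net_flow_image_outside[OF False] by (simp add: corner_flow_def)
      qed
    qed
  qed
  then have "flow_configs n d x y z = (\<lambda>A. map_prod ?f ?f ` A) ` flow_configs n (0, 0) x y z"
    unfolding flow_configs_def copy_edges_origin
    unfolding copy_edges_def orientations_image[OF \<open>inj ?f\<close>] by auto
  moreover have "inj_on (\<lambda>A. map_prod ?f ?f ` A) (flow_configs n (0, 0) x y z)"
    by (rule inj_onI) (simp add: inj_image_eq_iff prod.inj_map)
  ultimately show ?thesis by (simp add: flow_count_def card_image)
qed

text \<open>The parameters \<open>p\<close>, \<open>q\<close>, \<open>r\<close> are the flows that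
  the copies \<open>A\<close>, \<open>B\<close>, \<open>C\<close> contribute at the junctions
  \<open>(M, 0)\<close>, \<open>(M, M)\<close>, \<open>(0, M)\<close>. The total vanishes there, so
  the other copy at the junction contributes the opposite value. Each outer corner belongs to one
  copy, which must supply \<open>x\<close>, \<open>y\<close> or \<open>z\<close> alone.\<close>

lemma junction_decomposition:
  fixes n :: nat and x y z :: int
  defines "M \<equiv> 2 ^ n :: nat"
  assumes A: "A \<in> orientations (copy_edges n (0, 0))"
    and B: "B \<in> orientations (copy_edges n (M, 0))"
    and C: "C \<in> orientations (copy_edges n (0, M))"
  shows "(\<forall>v. net_flow A v + (net_flow B v + net_flow C v) = corner_flow (Suc n) (0, 0) x y z v) \<longleftrightarrow>
    (\<exists>p\<in>{-2, 0, 2}. \<exists>q\<in>{-2, 0, 2}. \<exists>r\<in>{-2, 0, 2}.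
      net_flow A = corner_flow n (0, 0) x p (- r) \<and>
      net_flow B = corner_flow n (M, 0) (- p) y q \<and>
      net_flow C = corner_flow n (0, M) r (- q) z)" (is "?L \<longleftrightarrow> ?R")
proof
  have M: "0 < M" by (simp add: M_def)
  have cf: "corner_flow (Suc n) (0, 0) x y z v =
      (if v = (0, 0) then x else 0) + (if v = (2 * M, 0) then y else 0) + (if v = (0, 2 * M) then z else 0)"
    "corner_flow n (0, 0) s t u v =
      (if v = (0, 0) then s else 0) + (if v = (M, 0) then t else 0) + (if v = (0, M) then u else 0)"
    "corner_flow n (M, 0) s t u v =
      (if v = (M, 0) then s else 0) + (if v = (2 * M, 0) then t else 0) + (if v = (M, M) then u else 0)"
    "corner_flow n (0, M) s t u v =
      (if v = (0, M) then s else 0) + (if v = (M, M) then t else 0) + (if v = (0, 2 * M) then u else 0)"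
    for s t u v
    by (simp_all add: corner_flow_def M_def mult_2)
  {
    assume ?R
    then show ?L using M by (auto simp: cf)
  }
  assume L: ?L
  have zero: "v \<notin> copy_vertices n (0, 0) \<Longrightarrow> net_flow A v = 0"
    "v \<notin> copy_vertices n (M, 0) \<Longrightarrow> net_flow B v = 0"
    "v \<notin> copy_vertices n (0, M) \<Longrightarrow> net_flow C v = 0" for v
    using net_flow_copy(1)[OF A] net_flow_copy(1)[OF B] net_flow_copy(1)[OF C] by blast+
  note j = junctions[of n, folded M_def]
  define p where "p = net_flow A (M, 0)"
  define q where "q = net_flow B (M, M)"
  define r where "r = net_flow C (0, M)"
  have W: "p \<in> {-2, 0, 2}" "q \<in> {-2, 0, 2}" "r \<in> {-2, 0, 2}"
    unfolding p_def q_def r_def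
    by (rule net_flow_copy(2)[OF A] net_flow_copy(2)[OF B] net_flow_copy(2)[OF C],
        simp add: copy_outmost_def M_def)+
  \<comment> \<open>The hypothesis at the six special points, where the incidence table removes the
    copies that are absent.\<close>
  have at: "net_flow A (0, 0) = x" "net_flow A (0, M) = - r"
    "net_flow B (M, 0) = - p" "net_flow B (2 * M, 0) = y"
    "net_flow C (M, M) = - q" "net_flow C (0, 2 * M) = z"
    using M L[rule_format, of "(0, 0)"] L[rule_format, of "(0, M)"]
      L[rule_format, of "(M, 0)"] L[rule_format, of "(2 * M, 0)"]
      L[rule_format, of "(M, M)"] L[rule_format, of "(0, 2 * M)"]
    by (simp_all add: zero j cf p_def q_def r_def)
  \<comment> \<open>At most one of the three copies contains \<open>v\<close>, so two summands
    vanish, and with the sum being zero so does the third.\<close>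
  have off: "net_flow A v = 0 \<and> net_flow B v = 0 \<and> net_flow C v = 0"
    if v: "v \<notin> {(0, 0), (M, 0), (0, M), (M, M), (2 * M, 0), (0, 2 * M)}" for v
  proof -
    have "net_flow A v + (net_flow B v + net_flow C v) = 0"
      using L[rule_format, of v] v by (simp add: cf)
    moreover have "\<not> (v \<in> copy_vertices n (0, 0) \<and> v \<in> copy_vertices n (M, 0))"
      "\<not> (v \<in> copy_vertices n (0, 0) \<and> v \<in> copy_vertices n (0, M))"
      "\<not> (v \<in> copy_vertices n (M, 0) \<and> v \<in> copy_vertices n (0, M))"
      using v copies_meet[of v n, folded M_def] by blast+
    ultimately show ?thesis using zero[of v] by (smt (verit))
  qed
  have "net_flow A v = corner_flow n (0, 0) x p (- r) v \<and>
      net_flow B v = corner_flow n (M, 0) (- p) y q v \<and>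
      net_flow C v = corner_flow n (0, M) r (- q) z v" for v
  proof (cases "v \<in> {(0, 0), (M, 0), (0, M), (M, M), (2 * M, 0), (0, 2 * M)}")
    case True
    then show ?thesis
      using M by (elim insertE emptyE) (simp_all add: cf at zero j flip: p_def q_def r_def)
  next
    case False
    then show ?thesis using off[OF False] by (simp add: cf)
  qed
  with W show ?R by blast
qed

text \<open>A transfer formula: sum over the junction flows, and for fixed junction flows choose the
  configurations of the three copies independently.\<close>

lemma flow_count_Suc:
  "flow_count (Suc n) x y z = (\<Sum>p\<in>{-2, 0, 2}. \<Sum>q\<in>{-2, 0, 2}. \<Sum>r\<in>{-2, 0, 2}.
     flow_count n x p (- r) * (flow_count n (- p) y q * flow_count n r (- q) z))"
proof -
  define M :: nat where "M = 2 ^ n"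
  have M: "0 < M" by (simp add: M_def)
  define W :: "int set" where "W = {-2, 0, 2}"
  let ?O = "\<lambda>d. orientations (copy_edges n d)"
  let ?U = "\<lambda>(A, B, C). A \<union> (B \<union> C)"
  let ?S = "?O (0, 0) \<times> ?O (M, 0) \<times> ?O (0, M)"
  let ?K = "\<lambda>(p, q, r). flow_configs n (0, 0) x p (- r) \<times>
     flow_configs n (M, 0) (- p) y q \<times> flow_configs n (0, M) r (- q) z"
  note disj = copy_edges_disjoint[of n, folded M_def]
  have bij: "bij_betw ?U ?S (orientations (sg_edges (Suc n)))"
    unfolding sg_edges_Suc M_def[symmetric] by (rule bij_betw_orientations_Un3[OF disj])
  have flow: "net_flow (?U (A, B, C)) v = net_flow A v + (net_flow B v + net_flow C v)"
    if "A \<in> ?O (0, 0)" "B \<in> ?O (M, 0)" "C \<in> ?O (0, M)" for A B C v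
  proof -
    have "A \<inter> B = {}" "A \<inter> C = {}" "B \<inter> C = {}"
      using that disj by (metis orientations_disjoint)+
    then show ?thesis
      using that by (simp add: net_flow_Un finite_copy_orientation Int_Un_distrib)
  qed
  have mem: "(A, B, C) \<in> (\<Union>t\<in>W \<times> W \<times> W. ?K t) \<longleftrightarrow>
      (\<exists>p\<in>W. \<exists>q\<in>W. \<exists>r\<in>W. A \<in> flow_configs n (0, 0) x p (- r) \<and>
        B \<in> flow_configs n (M, 0) (- p) y q \<and> C \<in> flow_configs n (0, M) r (- q) z)" for A B C
    by auto
  have "flow_configs (Suc n) (0, 0) x y z =
      ?U ` {t \<in> ?S. net_flow (?U t) = corner_flow (Suc n) (0, 0) x y z}"
    unfolding flow_configs_def copy_edges_origin bij_betw_imp_surj_on[OF bij, symmetric] by blast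
  moreover have "{t \<in> ?S. net_flow (?U t) = corner_flow (Suc n) (0, 0) x y z} = (\<Union>t\<in>W \<times> W \<times> W. ?K t)"
  proof -
    have "(A, B, C) \<in> ?S \<and> net_flow (?U (A, B, C)) = corner_flow (Suc n) (0, 0) x y z \<longleftrightarrow>
        (A, B, C) \<in> (\<Union>t\<in>W \<times> W \<times> W. ?K t)" for A B C
    proof (cases "A \<in> ?O (0, 0) \<and> B \<in> ?O (M, 0) \<and> C \<in> ?O (0, M)")
      case True
      then have ABC: "A \<in> ?O (0, 0)" "B \<in> ?O (M, 0)" "C \<in> ?O (0, M)" by blast+
      show ?thesis
        unfolding fun_eq_iff[of "net_flow (?U (A, B, C))"] flow[OF ABC]
          junction_decomposition[OF ABC[unfolded M_def], folded M_def W_def] mem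
        using ABC by (simp add: flow_configs_def)
    next
      case False
      then show ?thesis unfolding mem by (auto simp: flow_configs_def)
    qed
    then show ?thesis by (intro set_eqI) (simp only: split_paired_all mem_Collect_eq)
  qed
  ultimately have eq: "flow_configs (Suc n) (0, 0) x y z = ?U ` (\<Union>t\<in>W \<times> W \<times> W. ?K t)" by simp
  have "(\<Union>t\<in>W \<times> W \<times> W. ?K t) \<subseteq> ?S"
    by (auto simp: flow_configs_def)
  then have "inj_on ?U (\<Union>t\<in>W \<times> W \<times> W. ?K t)"
    by (rule inj_on_subset[OF bij_betw_imp_inj_on[OF bij]])
  then have "flow_count (Suc n) x y z = card (\<Union>t\<in>W \<times> W \<times> W. ?K t)"
    unfolding flow_count_def eq by (rule card_image)
  also have "\<dots> = (\<Sum>t\<in>W \<times> W \<times> W. card (?K t))"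
  proof (rule card_UN_disjoint)
    show "\<forall>t\<in>W \<times> W \<times> W. \<forall>t'\<in>W \<times> W \<times> W. t \<noteq> t' \<longrightarrow> ?K t \<inter> ?K t' = {}"
    proof (intro ballI impI equals0I)
      fix t t' X assume "t \<noteq> t'" and X: "X \<in> ?K t \<inter> ?K t'"
      obtain A B C where ABC: "X = (A, B, C)" using prod_cases3 .
      obtain p q r p' q' r' where t: "t = (p, q, r)" "t' = (p', q', r')" using prod_cases3 by metis
      \<comment> \<open>The flows of the three parts at \<open>(M, 0)\<close>, \<open>(M, M)\<close>
        and \<open>(0, M)\<close> give back \<open>p\<close>, \<open>q\<close> and \<open>r\<close>,
        so different triples yield disjoint classes.\<close>
      have "corner_flow n (0, 0) x p (- r) (M, 0) = corner_flow n (0, 0) x p' (- r') (M, 0)"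
        "corner_flow n (M, 0) (- p) y q (M, M) = corner_flow n (M, 0) (- p') y q' (M, M)"
        "corner_flow n (0, M) r (- q) z (0, M) = corner_flow n (0, M) r' (- q') z (0, M)"
        using X by (simp_all add: ABC t flow_configs_def) metis+
      then have "t = t'" using M by (simp add: t corner_flow_def flip: M_def)
      with \<open>t \<noteq> t'\<close> show False by simp
    qed
  qed (auto simp: W_def)
  also have "\<dots> = (\<Sum>p\<in>W. \<Sum>q\<in>W. \<Sum>r\<in>W.
     flow_count n x p (- r) * (flow_count n (- p) y q * flow_count n r (- q) z))"
    by (simp add: sum.cartesian_product' card_cartesian_product card_flow_configs case_prod_beta)
  finally show ?thesis unfolding W_def .
qed

section \<open>The counts\<close>

text \<open>These are \<open>a_n\<close> and \<open>b_n\<close> of the overview;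
  \<open>flow_count_eq\<close> links them to the configurations.\<close>

fun balanced_count polar_count :: "nat \<Rightarrow> nat" where
  "balanced_count 0 = 2"
| "balanced_count (Suc n) = balanced_count n ^ 3 + 2 * polar_count n ^ 3"
| "polar_count 0 = 1"
| "polar_count (Suc n) = balanced_count n * polar_count n ^ 2 + polar_count n ^ 3"

text \<open>The signs \<open>a\<close>, \<open>b\<close>, \<open>c\<close> direct the edges from
  \<open>(0, 0)\<close> to \<open>(1, 0)\<close>, from \<open>(0, 0)\<close> to
  \<open>(0, 1)\<close> and from \<open>(1, 0)\<close> to \<open>(0, 1)\<close>, with 1 meaning this
  direction and -1 the reverse. The three equations are the net flows at the corners, so the base
  case becomes a check of eight sign patterns.\<close>

lemma flow_count_0:
  "flow_count 0 x y z = (\<Sum>a\<in>{-1, 1}. \<Sum>b\<in>{-1, 1}. \<Sum>c\<in>{-1, 1}.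
     of_bool (- a - b = x \<and> a - c = y \<and> b + c = z))"
proof -
  let ?e = "\<lambda>(u :: point) v (s :: int). if s = 1 then {(u, v)} else {(v, u)}"
  let ?A = "\<lambda>a. ?e (0, 0) (1, 0) a" and ?B = "\<lambda>b. ?e (0, 0) (0, 1) b" and ?C = "\<lambda>c. ?e (1, 0) (0, 1) c"
  let ?U = "\<lambda>(A, B, C). A \<union> (B \<union> C)"
  let ?T = "{-1, 1} \<times> {-1, 1} \<times> {-1, 1} :: (int \<times> int \<times> int) set"
  let ?S = "orientations {{(0, 0), (1, 0)}} \<times> orientations {{(0, 0), (0, 1)}} \<times>
    orientations {{(1, 0), (0, 1)}} :: ((point \<times> point) set \<times> (point \<times> point) set \<times> (point \<times> point) set) set"
  let ?f = "map_prod ?A (map_prod ?B ?C)"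
  have "sg_edges 0 = {{(0, 0), (1, 0)}} \<union> ({{(0, 0), (0, 1)}} \<union> {{(1, 0), (0, 1)}})"
    by auto
  then have "bij_betw ?U ?S (orientations (sg_edges 0))"
    by (simp only:) (rule bij_betw_orientations_Un3, auto simp: doubleton_eq_iff)
  moreover have "bij_betw ?f ?T ?S"
  proof -
    have e: "bij_betw (?e u v) {-1, 1} (orientations {{u, v}})" if "u \<noteq> v" for u v
      using that by (auto simp: bij_betw_def inj_on_def orientations_edge)
    then show ?thesis by (intro bij_betw_map_prod e) auto
  qed
  ultimately have bij: "bij_betw (?U \<circ> ?f) ?T (orientations (sg_edges 0))"
    by (rule bij_betw_trans[rotated])
  have flow: "net_flow (?U (?f (a, b, c))) = corner_flow 0 (0, 0) x y z \<longleftrightarrow>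
      - a - b = x \<and> a - c = y \<and> b + c = z" if "(a, b, c) \<in> ?T" for a b c
  proof -
    have U: "?U (?f (a, b, c)) \<in> orientations (copy_edges 0 (0, 0))"
      unfolding copy_edges_origin using bij_betw_apply[OF bij that] by simp
    \<comment> \<open>Both sides vanish off the three vertices, which reduces the equality of
      functions to three values.\<close>
    have "net_flow (?U (?f (a, b, c))) v = 0" if "v \<notin> {(0, 0), (1, 0), (0, 1)}" for v
      by (rule net_flow_copy(1)[OF U, unfolded copy_vertices_origin]) (use that in simp)
    moreover have "corner_flow 0 (0, 0) x y z v = 0" if "v \<notin> {(0, 0), (1, 0), (0, 1)}" for v
      using that by (simp add: corner_flow_def)
    ultimately have "net_flow (?U (?f (a, b, c))) = corner_flow 0 (0, 0) x y z \<longleftrightarrow>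
        (\<forall>v \<in> {(0, 0), (1, 0), (0, 1)}. net_flow (?U (?f (a, b, c))) v = corner_flow 0 (0, 0) x y z v)"
      unfolding fun_eq_iff by metis
    moreover have "net_flow (?U (?f (a, b, c))) v = a * (of_bool (v = (1, 0)) - of_bool (v = (0, 0)))
        + (b * (of_bool (v = (0, 1)) - of_bool (v = (0, 0)))
        + c * (of_bool (v = (0, 1)) - of_bool (v = (1, 0))))" for v
    proof -
      have e: "net_flow (?e u w s) v = s * (of_bool (v = w) - of_bool (v = u))"
        if "s \<in> {-1, 1}" for u w s
        using that by (auto simp: net_flow_singleton)
      have "?A a \<inter> ?B b = {}" "?A a \<inter> ?C c = {}" "?B b \<inter> ?C c = {}" by simp_all
      moreover have "finite (?A a)" "finite (?B b)" "finite (?C c)" by simp_all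
      ultimately have "net_flow (?U (?f (a, b, c))) v = net_flow (?A a) v + (net_flow (?B b) v + net_flow (?C c) v)"
        unfolding map_prod_simp case_prod_conv by (simp only: net_flow_Un Int_Un_distrib finite_UnI Un_empty)
      then show ?thesis using that by (simp only: e mem_Times_iff fst_conv snd_conv)
    qed
    ultimately have "net_flow (?U (?f (a, b, c))) = corner_flow 0 (0, 0) x y z \<longleftrightarrow>
        (\<forall>v \<in> {(0, 0), (1, 0), (0, 1)}. a * (of_bool (v = (1, 0)) - of_bool (v = (0, 0)))
        + (b * (of_bool (v = (0, 1)) - of_bool (v = (0, 0)))
        + c * (of_bool (v = (0, 1)) - of_bool (v = (1, 0)))) = corner_flow 0 (0, 0) x y z v)"
      by (simp only:)
    then show ?thesis by (simp add: corner_flow_def)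
  qed
  have "flow_configs 0 (0, 0) x y z =
      (?U \<circ> ?f) ` {t \<in> ?T. net_flow ((?U \<circ> ?f) t) = corner_flow 0 (0, 0) x y z}"
    unfolding flow_configs_def copy_edges_origin bij_betw_imp_surj_on[OF bij, symmetric] by blast
  then have "flow_count 0 x y z = card {t \<in> ?T. net_flow ((?U \<circ> ?f) t) = corner_flow 0 (0, 0) x y z}"
    unfolding flow_count_def
    by (simp only:) (intro card_image inj_on_subset[OF bij_betw_imp_inj_on[OF bij]], blast)
  also have "{t \<in> ?T. net_flow ((?U \<circ> ?f) t) = corner_flow 0 (0, 0) x y z} =
      {t \<in> ?T. case t of (a, b, c) \<Rightarrow> - a - b = x \<and> a - c = y \<and> b + c = z}"
    using flow by (intro Collect_cong) (auto simp only: split_paired_all o_apply case_prod_conv)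
  also have "card \<dots> = (\<Sum>t\<in>?T. of_bool (case t of (a, b, c) \<Rightarrow> - a - b = x \<and> a - c = y \<and> b + c = z))"
    by (simp only: sum_of_bool_eq finite_cartesian_product finite.intros Int_def mem_Collect_eq of_nat_id)
  also have "\<dots> = (\<Sum>a\<in>{-1, 1}. \<Sum>b\<in>{-1, 1}. \<Sum>c\<in>{-1, 1}.
     of_bool (- a - b = x \<and> a - c = y \<and> b + c = z))"
    by (simp only: sum.cartesian_product' case_prod_conv)
  finally show ?thesis .
qed

text \<open>A term of the transfer formula survives only if the corner flows of every copy sum to 0.
  For \<open>x = y = z = 0\<close> this forces \<open>p = q = r\<close>: the value 0 gives
  \<open>a^3\<close> and the values 2 and -2 give \<open>b^3\<close> each. For flows
  \<open>(2, -2, 0)\<close> it forces \<open>q = r\<close> and \<open>p = r - 2\<close>: then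
  \<open>r = 0\<close> gives \<open>a b^2\<close>, \<open>r = 2\<close> gives \<open>b^3\<close>,
  and \<open>r = -2\<close> would need \<open>p = -4\<close>.\<close>

lemma flow_count_eq:
  assumes "x \<in> {-2, 0, 2}" "y \<in> {-2, 0, 2}" "z \<in> {-2, 0, 2}"
  shows "flow_count n x y z =
    (if x + y + z \<noteq> 0 then 0 else if x = 0 \<and> y = 0 then balanced_count n else polar_count n)"
  using assms
proof (induction n arbitrary: x y z)
  case 0
  then show ?case unfolding flow_count_0 by (elim insertE emptyE) simp_all
next
  case (Suc n)
  from Suc.prems show ?case
    unfolding flow_count_Suc by (elim insertE emptyE) (simp_all add: Suc.IH eval_nat_numeral)
qed

text \<open>Where in-degree and out-degree sum to 4, the ice rule says that they are equal, that is,
  that the net flow is 0. By \<open>sg_degree_eq\<close> only the corners escape this condition, and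
  there the flow is -2, 0 or 2.\<close>

lemma ice_configurations_eq: "ice_configurations n =
  (\<Union>(x, y, z) \<in> {-2, 0, 2} \<times> {-2, 0, 2} \<times> {-2, 0, 2}. flow_configs n (0, 0) x y z)"
proof (rule set_eqI)
  fix A
  show "A \<in> ice_configurations n \<longleftrightarrow> A \<in> (\<Union>(x, y, z) \<in> {-2, 0, 2} \<times> {-2, 0, 2} \<times> {-2, 0, 2}.
    flow_configs n (0, 0) x y z)"
  proof (cases "A \<in> orientations (sg_edges n)")
    case True
    then have A: "A \<in> orientations (copy_edges n (0, 0))" by (simp add: copy_edges_origin)
    have deg: "card {u. (u, v) \<in> A} + card {w. (v, w) \<in> A} = sg_degree n v" for v
      unfolding sg_degree_def
      by (rule card_in_arcs_add_card_out_arcs[OF True card_sg_edge finite_sg_edges])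
    have "(\<forall>v\<in>sg_vertices n. sg_degree n v = 4 \<longrightarrow>
        card {u. (u, v) \<in> A} = 2 \<and> card {w. (v, w) \<in> A} = 2) \<longleftrightarrow>
      (\<forall>v. v \<notin> sg_outmost n \<longrightarrow> net_flow A v = 0)" (is "?L \<longleftrightarrow> ?R")
    proof
      assume ?L
      show ?R
      proof (intro allI impI)
        fix v assume v: "v \<notin> sg_outmost n"
        show "net_flow A v = 0"
        proof (cases "v \<in> sg_vertices n")
          case True
          then show ?thesis using \<open>?L\<close> v by (simp add: sg_degree_eq net_flow_def)
        qed (use net_flow_copy(1)[OF A] in \<open>simp add: copy_vertices_origin\<close>)
      qed
    next
      assume R: ?R
      show ?L
      proof (intro ballI impI)
        fix v assume "sg_degree n v = 4"
        moreover from this have "net_flow A v = 0"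
          using R[rule_format, of v] by (simp add: sg_degree_eq split: if_splits)
        ultimately show "card {u. (u, v) \<in> A} = 2 \<and> card {w. (v, w) \<in> A} = 2"
          using deg[of v] by (simp add: net_flow_def)
      qed
    qed
    also have "\<dots> \<longleftrightarrow> (\<exists>x\<in>{-2, 0, 2}. \<exists>y\<in>{-2, 0, 2}. \<exists>z\<in>{-2, 0, 2}.
        net_flow A = corner_flow n (0, 0) x y z)" (is "?R \<longleftrightarrow> ?C")
    proof
      assume R: ?R
      have "net_flow A = corner_flow n (0, 0) (net_flow A (0, 0)) (net_flow A (2 ^ n, 0))
          (net_flow A (0, 2 ^ n))"
      proof
        fix v
        show "net_flow A v = corner_flow n (0, 0) (net_flow A (0, 0)) (net_flow A (2 ^ n, 0))
          (net_flow A (0, 2 ^ n)) v"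
          using R[rule_format, of v] by (cases "v \<in> sg_outmost n") (auto simp: corner_flow_def sg_outmost_def)
      qed
      moreover have "net_flow A v \<in> {-2, 0, 2}" if "v \<in> {(0, 0), (2 ^ n, 0), (0, 2 ^ n)}" for v
        using net_flow_copy(2)[OF A, of v] that unfolding copy_outmost_origin sg_outmost_def by blast
      ultimately show ?C by blast
    next
      assume ?C
      then show ?R by (auto simp: corner_flow_def sg_outmost_def)
    qed
    finally show ?thesis
      using True by (simp add: ice_configurations_def flow_configs_def copy_edges_origin)
  qed (auto simp: ice_configurations_def flow_configs_def copy_edges_origin)
qed

text \<open>The classes are disjoint because the corner flows can be read off a configuration. Of
  the 27 triples, one is balanced, six are permutations of \<open>(2, -2, 0)\<close>, and the others
  contribute 0.\<close>

lemma ice_count_eq: "ice_count n = balanced_count n + 6 * polar_count n"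
proof -
  define W :: "int set" where "W = {-2, 0, 2}"
  have "ice_count n = card (\<Union>t \<in> W \<times> W \<times> W. case t of (x, y, z) \<Rightarrow> flow_configs n (0, 0) x y z)"
    by (simp only: ice_count_def ice_configurations_eq W_def)
  also have "\<dots> = (\<Sum>t \<in> W \<times> W \<times> W. card (case t of (x, y, z) \<Rightarrow> flow_configs n (0, 0) x y z))"
  proof (rule card_UN_disjoint)
    have "(x, y, z) = (x', y', z')"
      if "A \<in> flow_configs n (0, 0) x y z" "A \<in> flow_configs n (0, 0) x' y' z'" for A x y z x' y' z'
    proof -
      have "corner_flow n (0, 0) x y z v = corner_flow n (0, 0) x' y' z' v" for v
        using that by (simp add: flow_configs_def)
      from this[of "(0, 0)"] this[of "(2 ^ n, 0)"] this[of "(0, 2 ^ n)"]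
      show ?thesis by (simp add: corner_flow_def)
    qed
    then show "\<forall>t\<in>W \<times> W \<times> W. \<forall>t'\<in>W \<times> W \<times> W. t \<noteq> t' \<longrightarrow>
        (case t of (x, y, z) \<Rightarrow> flow_configs n (0, 0) x y z) \<inter>
        (case t' of (x, y, z) \<Rightarrow> flow_configs n (0, 0) x y z) = {}"
      by fastforce
  qed (auto simp: W_def)
  also have "\<dots> = (\<Sum>x\<in>W. \<Sum>y\<in>W. \<Sum>z\<in>W. flow_count n x y z)"
    by (simp only: sum.cartesian_product' case_prod_conv flow_count_def)
  also have "\<dots> = balanced_count n + 6 * polar_count n"
    unfolding W_def by (simp add: flow_count_eq)
  finally show ?thesis .
qed

section \<open>The growth rate\<close>

text \<open>Twice the recursion for \<open>b\<close> is \<open>2 a b^2 + 2 b^3\<close>, to be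
  compared with \<open>a^3 + 2 b^3\<close>; so \<open>2 b^2 \<le> a^2\<close> suffices.\<close>

lemma counts_pos_le: "0 < polar_count n \<and> 2 * polar_count n \<le> balanced_count n"
proof (induction n)
  case (Suc n)
  let ?a = "balanced_count n" and ?b = "polar_count n"
  have "2 * ?b ^ 2 \<le> ?a ^ 2"
    using power_mono[OF Suc[THEN conjunct2], of 2] by (simp add: power_mult_distrib)
  then have "?a * (2 * ?b ^ 2) \<le> ?a * ?a ^ 2"
    by (rule mult_left_mono) simp
  moreover have "?a * ?a ^ 2 = ?a ^ 3" by (simp add: eval_nat_numeral)
  ultimately show ?case using Suc by (simp add: distrib_left)
qed simp

lemma polar_count_pos [simp]: "0 < polar_count n"
  and balanced_count_pos [simp]: "0 < balanced_count n"
  using counts_pos_le[of n] by auto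

definition count_ratio :: "nat \<Rightarrow> real" where
  "count_ratio n = real (polar_count n) / real (balanced_count n)"

lemma count_ratio_bounds: "0 < count_ratio n" "count_ratio n \<le> 1 / 2"
  using counts_pos_le[of n] by (simp_all add: count_ratio_def field_simps flip: of_nat_mult)

lemma count_ratio_Suc: "count_ratio (Suc n) =
    (count_ratio n ^ 2 + count_ratio n ^ 3) / (1 + 2 * count_ratio n ^ 3)"
proof -
  let ?a = "real (balanced_count n)"
  have "0 < ?a" by simp
  moreover have "real (polar_count n) = count_ratio n * ?a" by (simp add: count_ratio_def)
  ultimately have "count_ratio (Suc n) =
      (?a ^ 3 * (count_ratio n ^ 2 + count_ratio n ^ 3)) / (?a ^ 3 * (1 + 2 * count_ratio n ^ 3))"
    by (simp add: count_ratio_def[of "Suc n"] power_mult_distrib algebra_simps eval_nat_numeral)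
  with \<open>0 < ?a\<close> show ?thesis by (subst (asm) mult_divide_mult_cancel_left) simp_all
qed

text \<open>After clearing the denominator and a factor \<open>r\<close> the claim is
  \<open>r (1 + r) \<le> 1 + 2 r^3\<close>, whose left side is at most 3/4 because
  \<open>r \<le> 1/2\<close>.\<close>

lemma count_ratio_Suc_le: "count_ratio (Suc n) \<le> count_ratio n"
proof -
  let ?r = "count_ratio n"
  have r: "0 < ?r" "?r \<le> 1 / 2" by (fact count_ratio_bounds)+
  have "?r * (1 + ?r) \<le> 1 / 2 * (1 + 1 / 2)"
    using r by (intro mult_mono) auto
  also have "\<dots> \<le> 1 + 2 * ?r ^ 3" using r by simp
  finally have "?r * (?r * (1 + ?r)) \<le> ?r * (1 + 2 * ?r ^ 3)"
    using r by (intro mult_left_mono) auto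
  moreover have "0 < 1 + 2 * ?r ^ 3" using r by (simp add: add_pos_pos)
  ultimately show ?thesis
    by (simp add: count_ratio_Suc pos_divide_le_eq algebra_simps eval_nat_numeral)
qed

lemma ln_balanced_count_Suc: "ln (real (balanced_count (Suc n))) =
    3 * ln (real (balanced_count n)) + ln (1 + 2 * count_ratio n ^ 3)"
proof -
  let ?a = "real (balanced_count n)"
  have "real (balanced_count (Suc n)) = ?a ^ 3 * (1 + 2 * count_ratio n ^ 3)"
    by (simp add: count_ratio_def field_simps)
  moreover have "0 < 1 + 2 * count_ratio n ^ 3"
    using count_ratio_bounds[of n] by (simp add: add_pos_pos)
  ultimately show ?thesis
    by (simp add: ln_mult ln_realpow)
qed

definition lower_rate :: "nat \<Rightarrow> real" where
  "lower_rate n = ln (real (balanced_count n)) / 3 ^ n"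

text \<open>The correction bounds the tail: the limit of \<open>lower_rate\<close> exceeds
  \<open>lower_rate n\<close> by the sum of \<open>ln (1 + 2 r_k^3) / 3^(k+1)\<close> over
  \<open>k \<ge> n\<close>. Since \<open>r\<close> decreases, this is at most \<open>2 r_n^3\<close>
  times a geometric series with sum \<open>1 / (2 * 3^n)\<close>.\<close>

definition upper_rate :: "nat \<Rightarrow> real" where
  "upper_rate n = (ln (real (balanced_count n)) + count_ratio n ^ 3) / 3 ^ n"

lemma lower_rate_le_upper_rate: "lower_rate n \<le> upper_rate n"
  using count_ratio_bounds(1)[of n] by (simp add: lower_rate_def upper_rate_def divide_right_mono)

lemma incseq_lower_rate: "incseq lower_rate"
proof (rule incseq_SucI)
  fix n
  have "0 \<le> ln (1 + 2 * count_ratio n ^ 3)"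
    using count_ratio_bounds(1)[of n] by simp
  then show "lower_rate n \<le> lower_rate (Suc n)"
    unfolding lower_rate_def ln_balanced_count_Suc by (simp add: field_simps)
qed

text \<open>One step adds at most \<open>2 r_n^3\<close> to the logarithm, and the new correction is
  at most \<open>r_n^3\<close>; together they are the \<open>3 r_n^3\<close> that the factor 3
  allows.\<close>

lemma decseq_upper_rate: "decseq upper_rate"
proof (rule decseq_SucI)
  fix n
  have r: "0 < count_ratio n" "0 < count_ratio (Suc n)" by (fact count_ratio_bounds)+
  have "ln (1 + 2 * count_ratio n ^ 3) \<le> 2 * count_ratio n ^ 3"
    using r by (intro ln_add_one_self_le_self) simp
  moreover have "count_ratio (Suc n) ^ 3 \<le> count_ratio n ^ 3"
    using r count_ratio_Suc_le by (intro power_mono) auto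
  ultimately have "ln (real (balanced_count (Suc n))) + count_ratio (Suc n) ^ 3
      \<le> 3 * (ln (real (balanced_count n)) + count_ratio n ^ 3)"
    by (simp add: ln_balanced_count_Suc del: balanced_count.simps)
  then have "(ln (real (balanced_count (Suc n))) + count_ratio (Suc n) ^ 3) / 3 ^ Suc n
      \<le> 3 * (ln (real (balanced_count n)) + count_ratio n ^ 3) / 3 ^ Suc n"
    by (rule divide_right_mono) simp
  moreover have "3 * u / 3 ^ Suc n = u / 3 ^ n" for u :: real by simp
  ultimately show "upper_rate (Suc n) \<le> upper_rate n"
    unfolding upper_rate_def by (simp only:)
qed

lemma lower_rate_convergent:
  "\<exists>L. lower_rate \<longlonglongrightarrow> L \<and> (\<forall>n. lower_rate n \<le> L \<and> L \<le> upper_rate n)"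
proof -
  have *: "lower_rate m \<le> upper_rate n" for m n
  proof -
    have "lower_rate m \<le> lower_rate (max m n)"
      using incseq_lower_rate by (simp add: incseq_def)
    also have "\<dots> \<le> upper_rate (max m n)" by (rule lower_rate_le_upper_rate)
    also have "\<dots> \<le> upper_rate n"
      using decseq_upper_rate by (simp add: decseq_def)
    finally show ?thesis .
  qed
  obtain L where "lower_rate \<longlonglongrightarrow> L" "\<forall>n. lower_rate n \<le> L"
    using incseq_convergent[OF incseq_lower_rate, of "upper_rate 0"] * by blast
  moreover from this(1) have "L \<le> upper_rate n" for n
    using * by (intro LIMSEQ_le_const2) auto
  ultimately show ?thesis by blast
qed

section \<open>Numerical bounds at n = 4\<close>

lemma count_ratio_values:
  "count_ratio 0 = 1 / 2" "count_ratio 1 = 3 / 10" "count_ratio 2 = 117 / 1054"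
  "count_ratio 3 = 16029819 / 1174108690"
proof -
  show 0: "count_ratio 0 = 1 / 2" by (simp add: count_ratio_def)
  have "count_ratio (Suc 0) = 3 / 10"
    unfolding count_ratio_Suc 0 by (simp add: power_divide)
  then show 1: "count_ratio 1 = 3 / 10" by simp
  have "count_ratio (Suc 1) = 117 / 1054"
    unfolding count_ratio_Suc 1 by (simp add: power_divide)
  then show 2: "count_ratio 2 = 117 / 1054" by (simp add: numeral_2_eq_2)
  have "count_ratio (Suc 2) = 16029819 / 1174108690"
    unfolding count_ratio_Suc 2 by (simp add: power_divide)
  then show "count_ratio 3 = 16029819 / 1174108690" by simp
qed

text \<open>The recursion for the logarithm unrolled down to \<open>balanced_count 0 = 2\<close>.
  The logarithm of one huge integer is thus split into logarithms of small arguments, where series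
  converge fast.\<close>

lemma ln_balanced_count_4: "ln (real (balanced_count 4)) =
    81 * ln 2 + 27 * ln (5 / 4) + 9 * ln (527 / 500)
    + 3 * ln (1 + 2 * (117 / 1054) ^ 3) + ln (1 + 2 * (16029819 / 1174108690) ^ 3)"
proof -
  have 4: "ln (real (balanced_count 4)) = 3 * ln (real (balanced_count 3)) + ln (1 + 2 * count_ratio 3 ^ 3)"
   and 3: "ln (real (balanced_count 3)) = 3 * ln (real (balanced_count 2)) + ln (1 + 2 * count_ratio 2 ^ 3)"
   and 2: "ln (real (balanced_count (Suc 1))) = 3 * ln (real (balanced_count 1)) + ln (1 + 2 * count_ratio 1 ^ 3)"
   and 1: "ln (real (balanced_count 1)) = 3 * ln (real (balanced_count 0)) + ln (1 + 2 * count_ratio 0 ^ 3)"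
    using ln_balanced_count_Suc[of 3] ln_balanced_count_Suc[of 2]
      ln_balanced_count_Suc[of 1] ln_balanced_count_Suc[of 0]
    by (simp_all del: balanced_count.simps)
  have "1 + 2 * count_ratio 0 ^ 3 = 5 / 4" "1 + 2 * count_ratio 1 ^ 3 = 527 / 500"
    by (simp_all only: count_ratio_values) (simp_all add: power_divide)
  moreover have "Suc 1 = 2" "real (balanced_count 0) = 2" by simp_all
  ultimately show ?thesis using 1 2 3 4 by (simp only: count_ratio_values(3,4)) (simp add: algebra_simps)
qed

text \<open>The logarithm equals \<open>2 artanh y\<close>, and \<open>s\<close> is a partial sum of
  the artanh series. The error term replaces the denominators of the tail by the first one and sums
  the resulting geometric series of ratio \<open>y^2\<close>.\<close>

lemma ln_artanh_bounds:
  fixes y :: real and n :: nat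
  assumes "0 < y" "y < 1"
  defines "s \<equiv> \<Sum>k<n. y ^ (2 * k + 1) / real (2 * k + 1)"
  shows "ln ((1 + y) / (1 - y)) \<in> {2 * s .. 2 * s + 2 * y ^ (2 * n + 1) / (1 - y\<^sup>2) / real (2 * n + 1)}"
proof -
  have "((1 + y) / (1 - y) - 1) / ((1 + y) / (1 - y) + 1) = y"
    using assms by (simp add: field_simps)
  moreover have "1 < (1 + y) / (1 - y)" using assms by simp
  ultimately show ?thesis
    using ln_approx_bounds[of "(1 + y) / (1 - y)" n]
    by (simp add: s_def sum_distrib_left)
qed

text \<open>Since \<open>1 + 2 t = (1 + y) / (1 - y)\<close> for \<open>y = t / (1 + t)\<close>, each argument has a small rational \<open>y\<close>.\<close>

lemma ln_bounds:
  "ln 2 \<in> {0.6931471805599344 .. (0.6931471805599455::real)}"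
  "ln (5 / 4) \<in> {0.2231435513142091 .. (0.2231435513142098::real)}"
  "ln (527 / 500) \<in> {0.0525924501191692 .. (0.0525924501191706::real)}"
  "ln (1 + 2 * (117 / 1054) ^ 3) \<in> {0.0027319476829740 .. (0.0027319476829760::real)}"
  "ln (1 + 2 * (16029819 / 1174108690) ^ 3) \<in> {0.0000050896725084 .. (0.0000050896725085::real)}"
  \<comment> \<open>The smaller \<open>y\<close> is, the fewer terms are needed to bring the
    remainder below the width of the stated interval.\<close>
  subgoal using ln_artanh_bounds[of "1 / 3" 13] by (simp add: lessThan_nat_numeral lessThan_Suc power_divide)
  subgoal using ln_artanh_bounds[of "1 / 9" 7] by (simp add: lessThan_nat_numeral lessThan_Suc power_divide)
  subgoal using ln_artanh_bounds[of "27 / 1027" 4] by (simp add: lessThan_nat_numeral lessThan_Suc power_divide)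
  subgoal using ln_artanh_bounds[of "117 ^ 3 / (1054 ^ 3 + 117 ^ 3)" 2] by (simp add: lessThan_nat_numeral lessThan_Suc power_divide)
  subgoal using ln_artanh_bounds[of "16029819 ^ 3 / (1174108690 ^ 3 + 16029819 ^ 3)" 1]
    by (simp add: lessThan_nat_numeral lessThan_Suc power_divide)
  done

lemma rate_4_bounds:
  "0.515648810655 * 3 / 2 \<le> lower_rate 4" "upper_rate 4 < 0.515648810656 * 3 / 2"
proof -
  have "count_ratio 4 = (count_ratio 3 ^ 2 + count_ratio 3 ^ 3) / (1 + 2 * count_ratio 3 ^ 3)"
    using count_ratio_Suc[of 3] by simp
  \<comment> \<open>This crude bound is enough: the two rates differ by
    \<open>count_ratio 4 ^ 3 / 81\<close>, which is then below \<open>10^-13\<close>.\<close>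
  also have "\<dots> \<le> 2 / 10 ^ 4"
    unfolding count_ratio_values by (simp add: power_divide)
  finally have "count_ratio 4 ^ 3 \<le> (2 / 10 ^ 4) ^ 3"
    using count_ratio_bounds(1)[of 4] by (intro power_mono) auto
  then have t: "count_ratio 4 ^ 3 \<le> 8 / 10 ^ 12" by (simp add: power_divide)
  \<comment> \<open>With the logarithms replaced by real variables, both estimates are linear
    arithmetic.\<close>
  have lower: "0.515648810655 * 3 / 2 \<le> (81 * x + 27 * y + 9 * z + 3 * u + v) / 3 ^ 4"
    if "0.6931471805599344 \<le> x" "0.2231435513142091 \<le> y" "0.0525924501191692 \<le> z"
       "0.0027319476829740 \<le> u" "0.0000050896725084 \<le> v" for x y z u v :: real
    using that by simp
  have upper: "(81 * x + 27 * y + 9 * z + 3 * u + v + w) / 3 ^ 4 < 0.515648810656 * 3 / 2"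
    if "x \<le> 0.6931471805599455" "y \<le> 0.2231435513142098" "z \<le> 0.0525924501191706"
       "u \<le> 0.0027319476829760" "v \<le> 0.0000050896725085" "w \<le> 8 / 10 ^ 12"
    for x y z u v w :: real
    using that by simp
  note b = ln_bounds[unfolded atLeastAtMost_iff]
  show "0.515648810655 * 3 / 2 \<le> lower_rate 4"
    unfolding lower_rate_def ln_balanced_count_4
    by (rule lower) (use b in blast)+
  show "upper_rate 4 < 0.515648810656 * 3 / 2"
    unfolding upper_rate_def ln_balanced_count_4
    by (rule upper) (use b t in blast)+
qed

text \<open>Here \<open>ln I(n)\<close> is \<open>ln a_n\<close> plus \<open>ln (1 + 6 r_n)\<close>,
  and the second summand is bounded, so it disappears after division by \<open>3^n\<close>. The
  number of vertices divided by \<open>3^n\<close> tends to 3/2, hence the limit is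
  \<open>2 L / 3\<close>.\<close>

lemma growth_rate_limit:
  fixes I :: "nat \<Rightarrow> nat"
  assumes I: "\<And>n. I n = balanced_count n + 6 * polar_count n"
  shows "\<exists>S :: real. (\<lambda>n. ln (real (I n)) / (3 / 2 * (3 ^ n + 1))) \<longlonglongrightarrow> S \<and>
     0.515648810655 \<le> S \<and> S < 0.515648810656"
proof -
  obtain L where L: "lower_rate \<longlonglongrightarrow> L" "\<And>n. lower_rate n \<le> L" "\<And>n. L \<le> upper_rate n"
    using lower_rate_convergent by blast
  let ?h = "\<lambda>n. ln (1 + 6 * count_ratio n) / 3 ^ n"
  have third: "(\<lambda>n. (1 / 3 :: real) ^ n) \<longlonglongrightarrow> 0"
    by (intro LIMSEQ_realpow_zero) auto
  have "?h \<longlonglongrightarrow> 0"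
  proof (rule real_tendsto_sandwich)
    show "\<forall>\<^sub>F n in sequentially. 0 \<le> ?h n"
      using count_ratio_bounds(1) by (simp add: less_imp_le)
    have "ln (1 + 6 * count_ratio n) \<le> 3" for n
      \<comment> \<open>From \<open>ln (1 + x) \<le> x\<close> with \<open>x = 6 r_n\<close>, which
        is at most 3 because \<open>r_n \<le> 1/2\<close>.\<close>
      using ln_add_one_self_le_self[of "6 * count_ratio n"] count_ratio_bounds[of n] by simp
    then show "\<forall>\<^sub>F n in sequentially. ?h n \<le> 3 * (1 / 3) ^ n"
      by (simp add: power_divide divide_right_mono)
    show "(\<lambda>n. 3 * (1 / 3 :: real) ^ n) \<longlonglongrightarrow> 0"
      using tendsto_mult_left[OF third, of 3] by simp
  qed simp
  then have "(\<lambda>n. (lower_rate n + ?h n) / (3 / 2 * (1 + (1 / 3) ^ n))) \<longlonglongrightarrow>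
      (L + 0) / (3 / 2 * (1 + 0))"
    using L(1) third by (intro tendsto_intros) auto
  moreover have "(lower_rate n + ?h n) / (3 / 2 * (1 + (1 / 3) ^ n))
      = ln (real (I n)) / (3 / 2 * (3 ^ n + 1))" for n
  proof -
    have "real (I n) = real (balanced_count n) * (1 + 6 * count_ratio n)"
      by (simp add: I count_ratio_def field_simps)
    moreover have "0 < 1 + 6 * count_ratio n"
      using count_ratio_bounds(1)[of n] by simp
    ultimately have "lower_rate n + ?h n = ln (real (I n)) / 3 ^ n"
      by (simp add: lower_rate_def ln_mult add_divide_distrib)
    moreover have "3 / 2 * (3 ^ n + 1) = 3 ^ n * (3 / 2 * (1 + (1 / 3 :: real) ^ n))"
      by (simp add: field_simps)
    ultimately show ?thesis by (simp only: divide_divide_eq_left)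
  qed
  moreover have "0.515648810655 \<le> (L + 0) / (3 / 2 * (1 + 0))"
    "(L + 0) / (3 / 2 * (1 + 0)) < 0.515648810656"
    using rate_4_bounds L(2,3)[of 4] by simp_all
  ultimately show ?thesis by auto
qed

theorem proposition3p1:
  "\<exists>S :: real. (\<lambda>n. ln (real (ice_count n)) / real (card (sg_vertices n))) \<longlonglongrightarrow> S \<and>
     0.515648810655 \<le> S \<and> S < 0.515648810656"
  unfolding card_sg_vertices by (rule growth_rate_limit[OF ice_count_eq])

end
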